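(* Let $\mathbf S=(S,+,0,\delta)$ be a weak contact semilattice. Then the following conditions are equivalent. (1) $\mathbf S$ can be embedded into a weak contact Boolean algebra. (2) $\mathbf S$ can be embedded into a weak contact distributive lattice. (3) For every $a,b,c_0,c_1\in S$, if $b\le a+c_0$, $b\le a+c_1$ and not $c_0\mathrel{\delta}c_1$, then $b\le a$. (4) $\mathbf S$ can be embedded into a weak contact complete atomic Boolean algebra.
   Context: Semilattices are join semilattices with a minimum element $0$; the operation is written $+$ and the order is $a\le b$ iff $a+b=b$. Distributive lattices are also assumed to have a minimum $0$. A weak contact relation on a poset with $0$ (in particular on a semilattice, distributive lattice or Boolean algebra, with its order) is a binary relation $\delta$ such that, for all elements: (Sym) $a\mathrel{\delta}b$ iff $b\mathrel{\delta}a$; (Emp) $a\mathrel{\delta}b$ implies $a>0$ and $b>0$; (Ext) $a\mathrel{\delta}b$, $a\le a_1$ and $b\le b_1$ imply $a_1\mathrel{\delta}b_1$; (Ref) $n\ne0$ implies $n\mathrel{\delta}n$. A weak contact semilattice is a structure $(S,+,0,\delta)$ where $(S,+,0)$ is a semilattice with $0$ and $\delta$ is a weak contact relation on it. A weak contact distributive lattice (respectively, Boolean algebra) is a distributive lattice (respectively, Boolean algebra) with a weak contact relation; the relation is not assumed to be additive, nor to be given by the existence of a nonzero common lower bound. An embedding $\varphi$ of (weak) contact semilattices is an injective map preserving $0$ and $+$ such that $a\mathrel{\delta}b$ if and only if $\varphi(a)\mathrel{\delta}\varphi(b)$, for all $a,b$ in the domain. When $\mathbf S$ is said to be embedded into a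 Boolean algebra or distributive lattice with a contact relation, this means an embedding into its reduct in the language $\{+,0,\delta\}$, where $+$ is join; preservation of meets, complements, or a maximum is not required. *)

theory Defs
  imports "HOL-Algebra.Complete_Lattice"
begin

text \<open>
  The carrier and the order come from HOL-Algebra: the semilattice operation $+$ is the binary
  supremum \<open>\<squnion>\<close> and $0$ is \<open>\<bottom>\<close>, so that $a \le b$ iff $a + b = b$.
  The contact relation is unconstrained outside the carrier.
\<close>

record 'a contact_order = "'a gorder" +
  contact :: "['a, 'a] \<Rightarrow> bool" (infix \<open>\<delta>\<index>\<close> 50)

locale weak_contact =
  partial_order S + weak_partial_order_bottom S
  for S :: "('a, 'm) contact_order_scheme" (structure) +
  assumes contact_sym:
      "\<lbrakk>a \<in> carrier S; b \<in> carrier S\<rbrakk> \<Longrightarrow> a \<delta> b \<longleftrightarrow> b \<delta> a"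
    and contact_emp:
      "\<lbrakk>a \<in> carrier S; b \<in> carrier S; a \<delta> b\<rbrakk> \<Longrightarrow> \<bottom> \<sqsubset> a \<and> \<bottom> \<sqsubset> b"
    and contact_ext:
      "\<lbrakk>a \<in> carrier S; b \<in> carrier S; a1 \<in> carrier S; b1 \<in> carrier S;
        a \<delta> b; a \<sqsubseteq> a1; b \<sqsubseteq> b1\<rbrakk> \<Longrightarrow> a1 \<delta> b1"
    and contact_ref:
      "\<lbrakk>n \<in> carrier S; n \<noteq> \<bottom>\<rbrakk> \<Longrightarrow> n \<delta> n"

locale weak_contact_semilattice = upper_semilattice S + weak_contact S
  for S :: "('a, 'm) contact_order_scheme" (structure)

locale distributive_lattice = lattice +
  assumes meet_join_distrib:
    "\<lbrakk>x \<in> carrier L; y \<in> carrier L; z \<in> carrier L\<rbrakk>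
      \<Longrightarrow> x \<sqinter> (y \<squnion> z) = (x \<sqinter> y) \<squnion> (x \<sqinter> z)"

locale boolean_lattice = bounded_lattice + distributive_lattice +
  assumes complement_exists:
    "x \<in> carrier L \<Longrightarrow> \<exists>y\<in>carrier L. x \<squnion> y = \<top> \<and> x \<sqinter> y = \<bottom>"

definition atom :: "('a, 'm) gorder_scheme \<Rightarrow> 'a \<Rightarrow> bool" where
  "atom L p \<longleftrightarrow> p \<in> carrier L \<and> p \<noteq> \<bottom>\<^bsub>L\<^esub> \<and>
     (\<forall>x\<in>carrier L. x \<sqsubseteq>\<^bsub>L\<^esub> p \<longrightarrow> x = \<bottom>\<^bsub>L\<^esub> \<or> x = p)"

locale atomic_boolean_lattice = boolean_lattice +
  assumes atom_below:
    "\<lbrakk>x \<in> carrier L; x \<noteq> \<bottom>\<rbrakk> \<Longrightarrow> \<exists>p. atom L p \<and> p \<sqsubseteq> x"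

text \<open>The minimum of the distributive lattice is supplied by \<^locale>\<open>weak_contact\<close>; no maximum is required.\<close>

locale weak_contact_distributive_lattice = distributive_lattice L + weak_contact L
  for L :: "('a, 'm) contact_order_scheme" (structure)

locale weak_contact_boolean_algebra = boolean_lattice L + weak_contact L
  for L :: "('a, 'm) contact_order_scheme" (structure)

locale weak_contact_complete_atomic_boolean_algebra =
  complete_lattice L + atomic_boolean_lattice L + weak_contact L
  for L :: "('a, 'm) contact_order_scheme" (structure)

definition contact_embedding ::
  "('a, 'm) contact_order_scheme \<Rightarrow> ('b, 'n) contact_order_scheme \<Rightarrow> ('a \<Rightarrow> 'b) \<Rightarrow> bool" where
  "contact_embedding S T \<phi> \<longleftrightarrow>
     \<phi> \<in> carrier S \<rightarrow> carrier T \<and>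
     inj_on \<phi> (carrier S) \<and>
     \<phi> \<bottom>\<^bsub>S\<^esub> = \<bottom>\<^bsub>T\<^esub> \<and>
     (\<forall>a\<in>carrier S. \<forall>b\<in>carrier S. \<phi> (a \<squnion>\<^bsub>S\<^esub> b) = \<phi> a \<squnion>\<^bsub>T\<^esub> \<phi> b) \<and>
     (\<forall>a\<in>carrier S. \<forall>b\<in>carrier S. a \<delta>\<^bsub>S\<^esub> b \<longleftrightarrow> \<phi> a \<delta>\<^bsub>T\<^esub> \<phi> b)"

text \<open>
  \<open>S\<close> embeds into a structure of the class \<open>K\<close> whose carrier is a subset of the type \<open>'b\<close>.
  An existential in HOL cannot range over types, so the ambient type \<open>'b\<close> is a parameter.
  For a semilattice \<open>S\<close> on \<open>'a\<close>, the type \<open>'a set set\<close> has room for the powerset of the set of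
  ideals of \<open>S\<close>. A statement about all targets, of whatever size, follows from one about
  \<open>TYPE('a set set)\<close> once embeddability at an arbitrary type is shown to imply it there.
\<close>

definition embeddable ::
  "'b itself \<Rightarrow> ('b contact_order \<Rightarrow> bool) \<Rightarrow> ('a, 'm) contact_order_scheme \<Rightarrow> bool" where
  "embeddable U K S \<longleftrightarrow> (\<exists>T \<phi>. K T \<and> contact_embedding S T \<phi>)"

end

theory Submission
  imports Defs
begin

text \<open>
  In a weak contact distributive lattice, two elements with a nonzero meet are in contact, since the
  meet is in contact with itself. So elements $c_0, c_1$ out of contact are disjoint, and
  $b \le a + c_0$ and $b \le a + c_1$ give $b \le (a + c_0)(a + c_1) = a + c_0c_1 = a$. Embeddings
  preserve and reflect both the order and the contact, so this cancellation law passes down to every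
  semilattice with such an extension (\<open>contact_cancellative_if_embeddable\<close>).

  Conversely, assume the cancellation law and represent \<open>S\<close> by sets of \<^emph>\<open>clans\<close>: sets of
  elements in pairwise contact whose complement is closed under joins and under smaller elements.
  The element $a$ goes to the set of clans through it, and joins become unions. The essential point
  is injectivity: whenever $b \not\le a$, there is a clan that contains $b$ and not $a$
  (\<open>clan_separates\<close>). Take an ideal $M \ni a$ that is maximal among those avoiding $b$. If
  $c_0, c_1 \notin M$, then by maximality $b \le i + c_0$ and $b \le i + c_1$ for some $i \in M$; were
  $c_0$ and $c_1$ not in contact, the law would give $b \le i$, against $b \notin M$. So the
  complement of $M$ is a clan.

  On the powerset take the least weak contact relation for which the map preserves contact: two sets
  are in contact if they intersect or if they contain the images of two elements in contact. That a
  contact between images reflects back to \<open>S\<close> is clear in the second case, and in the first case it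
  is what pairwise contact inside a clan provides. A clan is a set of elements of \<open>S\<close>, so the
  powerset lives in \<open>'a set set\<close>, whatever the type of the lattice from which the law was deduced.
\<close>


section \<open>Contact embeddings into distributive lattices\<close>

lemma (in upper_semilattice) le_iff_join_eq:
  assumes "x \<in> carrier L" "y \<in> carrier L"
  shows "x \<sqsubseteq> y \<longleftrightarrow> x \<squnion> y = y"
  using assms join_left[of x y] join_right[of x y] join_le[of x y y] le_antisym[of "x \<squnion> y" y]
  by auto

lemma contact_embedding_le_iff:
  assumes S: "upper_semilattice S" and T: "upper_semilattice T"
    and emb: "contact_embedding S T \<phi>" and a: "a \<in> carrier S" and b: "b \<in> carrier S"
  shows "\<phi> a \<sqsubseteq>\<^bsub>T\<^esub> \<phi> b \<longleftrightarrow> a \<sqsubseteq>\<^bsub>S\<^esub> b"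
proof -
  interpret S: upper_semilattice S by fact
  interpret T: upper_semilattice T by fact
  have "\<phi> a \<in> carrier T" "\<phi> b \<in> carrier T" "\<phi> (a \<squnion>\<^bsub>S\<^esub> b) = \<phi> a \<squnion>\<^bsub>T\<^esub> \<phi> b"
    and inj: "inj_on \<phi> (carrier S)"
    using emb a b unfolding contact_embedding_def by auto
  then show ?thesis
    using S.le_iff_join_eq[OF a b] T.le_iff_join_eq[of "\<phi> a" "\<phi> b"]
      inj_on_eq_iff[OF inj, of "a \<squnion>\<^bsub>S\<^esub> b" b] S.join_closed[OF a b] a b
    by auto
qed

text \<open>
  The law says that two elements out of contact behave, with respect to joins, as if they were
  disjoint: $b \le a + c_0$ and $b \le a + c_1$ would give $b \le a + c_0c_1$ in a distributive lattice.
\<close>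

locale contact_cancellative_semilattice = weak_contact_semilattice +
  assumes contact_cancel:
    "\<lbrakk>a \<in> carrier S; b \<in> carrier S; c0 \<in> carrier S; c1 \<in> carrier S;
      b \<sqsubseteq> a \<squnion> c0; b \<sqsubseteq> a \<squnion> c1; \<not> c0 \<delta> c1\<rbrakk> \<Longrightarrow> b \<sqsubseteq> a"

lemma (in weak_contact_distributive_lattice) not_contact_imp_meet_bottom:
  assumes c: "c0 \<in> carrier L" "c1 \<in> carrier L" and nc: "\<not> c0 \<delta> c1"
  shows "c0 \<sqinter> c1 = \<bottom>"
proof (rule ccontr)
  assume "c0 \<sqinter> c1 \<noteq> \<bottom>"
  then have "(c0 \<sqinter> c1) \<delta> (c0 \<sqinter> c1)"
    using c by (intro contact_ref) auto
  then have "c0 \<delta> c1"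
    using c meet_left[of c0 c1] meet_right[of c0 c1]
      contact_ext[of "c0 \<sqinter> c1" "c0 \<sqinter> c1" c0 c1] by auto
  with nc show False ..
qed

lemma (in weak_contact_distributive_lattice) contact_cancellative:
  "contact_cancellative_semilattice L"
proof unfold_locales
  fix a b c0 c1
  assume carr: "a \<in> carrier L" "b \<in> carrier L" "c0 \<in> carrier L" "c1 \<in> carrier L"
    and le: "b \<sqsubseteq> a \<squnion> c0" "b \<sqsubseteq> a \<squnion> c1" and nc: "\<not> c0 \<delta> c1"
  have "(a \<squnion> c0) \<sqinter> c1 = (c1 \<sqinter> a) \<squnion> \<bottom>"
    using meet_join_distrib[of c1 a c0] not_contact_imp_meet_bottom[of c0 c1] carr nc
    by (simp add: meet_comm)
  also have "\<dots> \<sqsubseteq> a"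
    using carr by (intro join_le meet_right) auto
  finally have 1: "(a \<squnion> c0) \<sqinter> c1 \<sqsubseteq> a" .
  have "b \<sqsubseteq> (a \<squnion> c0) \<sqinter> (a \<squnion> c1)"
    using carr le by (intro meet_le) auto
  also have "(a \<squnion> c0) \<sqinter> (a \<squnion> c1) = ((a \<squnion> c0) \<sqinter> a) \<squnion> ((a \<squnion> c0) \<sqinter> c1)"
    using carr by (intro meet_join_distrib) auto
  also have "\<dots> \<sqsubseteq> a"
    using carr 1 by (intro join_le meet_right) auto
  finally show "b \<sqsubseteq> a"
    using carr by auto
qed

text \<open>
  The cancellation law is universal and mentions only joins, the order and contact, all of which
  an embedding preserves and reflects.
\<close>

lemma contact_cancellative_if_embeddable:
  fixes U :: "'b itself"
  assumes S: "weak_contact_semilattice S"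
    and "embeddable U weak_contact_distributive_lattice S"
  shows "contact_cancellative_semilattice S"
proof -
  obtain T :: "'b contact_order" and \<phi> where
    T: "weak_contact_distributive_lattice T" and emb: "contact_embedding S T \<phi>"
    using assms(2) unfolding embeddable_def by blast
  interpret S: weak_contact_semilattice S by fact
  interpret T: weak_contact_distributive_lattice T by fact
  interpret T': contact_cancellative_semilattice T by (rule T.contact_cancellative)
  have le_iff: "\<phi> x \<sqsubseteq>\<^bsub>T\<^esub> \<phi> y \<longleftrightarrow> x \<sqsubseteq>\<^bsub>S\<^esub> y" if "x \<in> carrier S" "y \<in> carrier S" for x y
    using contact_embedding_le_iff[OF _ _ emb that] S.upper_semilattice_axioms
      T.upper_semilattice_axioms by blast
  have cl: "\<phi> x \<in> carrier T" if "x \<in> carrier S" for x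
    using emb that unfolding contact_embedding_def by auto
  have join: "\<phi> (x \<squnion>\<^bsub>S\<^esub> y) = \<phi> x \<squnion>\<^bsub>T\<^esub> \<phi> y"
    and contact: "x \<delta>\<^bsub>S\<^esub> y \<longleftrightarrow> \<phi> x \<delta>\<^bsub>T\<^esub> \<phi> y" if "x \<in> carrier S" "y \<in> carrier S" for x y
    using emb that unfolding contact_embedding_def by auto
  show ?thesis
  proof unfold_locales
    fix a b c0 c1
    assume carr: "a \<in> carrier S" "b \<in> carrier S" "c0 \<in> carrier S" "c1 \<in> carrier S"
      and le: "b \<sqsubseteq>\<^bsub>S\<^esub> a \<squnion>\<^bsub>S\<^esub> c0" "b \<sqsubseteq>\<^bsub>S\<^esub> a \<squnion>\<^bsub>S\<^esub> c1" and nc: "\<not> c0 \<delta>\<^bsub>S\<^esub> c1"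
    have "\<phi> b \<sqsubseteq>\<^bsub>T\<^esub> \<phi> a \<squnion>\<^bsub>T\<^esub> \<phi> c0" "\<phi> b \<sqsubseteq>\<^bsub>T\<^esub> \<phi> a \<squnion>\<^bsub>T\<^esub> \<phi> c1" "\<not> \<phi> c0 \<delta>\<^bsub>T\<^esub> \<phi> c1"
      using le nc le_iff[of b "a \<squnion>\<^bsub>S\<^esub> c0"] le_iff[of b "a \<squnion>\<^bsub>S\<^esub> c1"] carr join contact by auto
    then have "\<phi> b \<sqsubseteq>\<^bsub>T\<^esub> \<phi> a"
      using carr cl T'.contact_cancel[of "\<phi> a" "\<phi> b" "\<phi> c0" "\<phi> c1"] by auto
    then show "b \<sqsubseteq>\<^bsub>S\<^esub> a"
      using le_iff carr by auto
  qed
qed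


section \<open>Ideals and clans\<close>

text \<open>
  The equivalence packs closure under joins and under smaller elements into one condition. The
  empty set is admitted.
\<close>

definition join_ideal :: "('a, 'm) gorder_scheme \<Rightarrow> 'a set \<Rightarrow> bool" where
  "join_ideal L I \<longleftrightarrow> I \<subseteq> carrier L \<and>
     (\<forall>x\<in>carrier L. \<forall>y\<in>carrier L. x \<squnion>\<^bsub>L\<^esub> y \<in> I \<longleftrightarrow> x \<in> I \<and> y \<in> I)"

definition clan :: "('a, 'm) contact_order_scheme \<Rightarrow> 'a set \<Rightarrow> bool" where
  "clan S F \<longleftrightarrow> F \<subseteq> carrier S \<and>
     (\<forall>x\<in>carrier S. \<forall>y\<in>carrier S. x \<squnion>\<^bsub>S\<^esub> y \<in> F \<longleftrightarrow> x \<in> F \<or> y \<in> F) \<and>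
     (\<forall>x\<in>F. \<forall>y\<in>F. x \<delta>\<^bsub>S\<^esub> y)"

lemma join_ideal_subset: "join_ideal L I \<Longrightarrow> I \<subseteq> carrier L"
  by (simp add: join_ideal_def)

lemma join_ideal_join_iff:
  assumes "join_ideal L I" "x \<in> carrier L" "y \<in> carrier L"
  shows "x \<squnion>\<^bsub>L\<^esub> y \<in> I \<longleftrightarrow> x \<in> I \<and> y \<in> I"
  using assms by (simp add: join_ideal_def)

lemma (in upper_semilattice) join_ideal_downward:
  assumes "join_ideal L I" "x \<in> carrier L" "y \<in> I" "x \<sqsubseteq> y"
  shows "x \<in> I"
  using assms le_iff_join_eq[of x y] unfolding join_ideal_def by (metis subsetD)

lemma (in upper_semilattice) le_join_mono:
  assumes "x \<sqsubseteq> i \<squnion> c" "i \<sqsubseteq> k"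
    and carr: "x \<in> carrier L" "i \<in> carrier L" "k \<in> carrier L" "c \<in> carrier L"
  shows "x \<sqsubseteq> k \<squnion> c"
proof -
  have "i \<sqsubseteq> k \<squnion> c"
    using le_trans[OF \<open>i \<sqsubseteq> k\<close> join_left[of k c]] carr by simp
  then have "i \<squnion> c \<sqsubseteq> k \<squnion> c"
    using join_le[OF _ join_right[of k c]] carr by simp
  then show ?thesis
    using le_trans[OF \<open>x \<sqsubseteq> i \<squnion> c\<close>] carr by simp
qed

lemma (in upper_semilattice) join_ideal_principal:
  assumes a: "a \<in> carrier L"
  shows "join_ideal L {x \<in> carrier L. x \<sqsubseteq> a}"
proof -
  have "x \<squnion> y \<sqsubseteq> a \<longleftrightarrow> x \<sqsubseteq> a \<and> y \<sqsubseteq> a" if "x \<in> carrier L" "y \<in> carrier L" for x y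
    using that a join_le[of x a y] le_trans[OF join_left[of x y], of a]
      le_trans[OF join_right[of x y], of a] by auto
  then show ?thesis
    unfolding join_ideal_def by auto
qed

text \<open>The ideal generated by \<open>c\<close> and a nonempty ideal \<open>I\<close>, which maximality is tested against.\<close>

lemma (in upper_semilattice) join_ideal_adjoin:
  assumes I: "join_ideal L I" and c: "c \<in> carrier L"
  shows "join_ideal L {x \<in> carrier L. \<exists>i\<in>I. x \<sqsubseteq> i \<squnion> c}" (is "join_ideal L ?J")
  unfolding join_ideal_def
proof (intro conjI ballI iffI)
  fix x y assume xy: "x \<in> carrier L" "y \<in> carrier L"
  have sub: "I \<subseteq> carrier L" using join_ideal_subset[OF I] .
  {
    assume "x \<squnion> y \<in> ?J"
    then obtain i where i: "i \<in> I" "x \<squnion> y \<sqsubseteq> i \<squnion> c" by blast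
    then have "x \<sqsubseteq> i \<squnion> c" "y \<sqsubseteq> i \<squnion> c"
      using xy c sub le_trans[OF join_left[OF xy], of "i \<squnion> c"]
        le_trans[OF join_right[OF xy], of "i \<squnion> c"] by auto
    then show "x \<in> ?J" "y \<in> ?J" using i xy by blast+
  }
  assume "x \<in> ?J \<and> y \<in> ?J"
  then obtain i j where ij: "i \<in> I" "j \<in> I" "x \<sqsubseteq> i \<squnion> c" "y \<sqsubseteq> j \<squnion> c" by blast
  then have carr: "i \<in> carrier L" "j \<in> carrier L" using sub by auto
  then have k: "i \<squnion> j \<in> I" using join_ideal_join_iff[OF I] ij carr by simp
  have "x \<sqsubseteq> (i \<squnion> j) \<squnion> c" "y \<sqsubseteq> (i \<squnion> j) \<squnion> c"
    using le_join_mono[OF ij(3) join_left[of i j]] le_join_mono[OF ij(4) join_right[of i j]]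
      carr c xy by simp_all
  then have "x \<squnion> y \<sqsubseteq> (i \<squnion> j) \<squnion> c"
    using xy carr c by (intro join_le) auto
  then show "x \<squnion> y \<in> ?J" using k xy by auto
qed auto

text \<open>Two elements of the union of a chain of ideals already lie in a common member.\<close>

lemma join_ideal_Union_chain:
  assumes chain: "subset.chain {I. join_ideal L I} C"
  shows "join_ideal L (\<Union>C)"
  unfolding join_ideal_def
proof (intro conjI ballI iffI)
  have ideal: "join_ideal L I" if "I \<in> C" for I
    using that chain unfolding subset.chain_def by blast
  show "\<Union>C \<subseteq> carrier L"
    using join_ideal_subset[OF ideal] by blast
  fix x y assume xy: "x \<in> carrier L" "y \<in> carrier L"
  show "x \<in> \<Union>C" "y \<in> \<Union>C" if "x \<squnion>\<^bsub>L\<^esub> y \<in> \<Union>C"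
    using that ideal xy unfolding join_ideal_def by blast+
  assume "x \<in> \<Union>C \<and> y \<in> \<Union>C"
  then obtain I J where IJ: "I \<in> C" "J \<in> C" "x \<in> I" "y \<in> J" by blast
  have "I \<subseteq> J \<or> J \<subseteq> I"
    using IJ chain unfolding subset.chain_def by blast
  then show "x \<squnion>\<^bsub>L\<^esub> y \<in> \<Union>C"
    using IJ ideal xy unfolding join_ideal_def by blast
qed

text \<open>
  Zorn's lemma yields an ideal that contains \<open>a\<close> and is maximal among those without \<open>b\<close>. Adjoining
  any further element \<open>c\<close> must then capture \<open>b\<close>.
\<close>

lemma (in upper_semilattice) maximal_ideal_avoiding:
  assumes a: "a \<in> carrier L" and b: "b \<in> carrier L" and nle: "\<not> b \<sqsubseteq> a"
  obtains M where "join_ideal L M" "a \<in> M" "b \<notin> M"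
    "\<And>c. \<lbrakk>c \<in> carrier L; c \<notin> M\<rbrakk> \<Longrightarrow> \<exists>i\<in>M. b \<sqsubseteq> i \<squnion> c"
proof -
  define A where "A = {I. join_ideal L I \<and> a \<in> I \<and> b \<notin> I}"
  have "{x \<in> carrier L. x \<sqsubseteq> a} \<in> A"
    using join_ideal_principal[OF a] a nle unfolding A_def by auto
  then have "A \<noteq> {}" by blast
  moreover have "\<Union>C \<in> A" if "C \<noteq> {}" "subset.chain A C" for C
  proof -
    have "subset.chain {I. join_ideal L I} C"
      using that unfolding subset.chain_def A_def by blast
    from join_ideal_Union_chain[OF this] show ?thesis
      using that unfolding subset.chain_def A_def by blast
  qed
  ultimately obtain M where M: "M \<in> A" and max: "\<And>X. X \<in> A \<Longrightarrow> M \<subseteq> X \<Longrightarrow> X = M"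
    using subset_Zorn_nonempty[of A] by blast
  have ideal: "join_ideal L M" and aM: "a \<in> M" and bM: "b \<notin> M"
    using M unfolding A_def by auto
  have sub: "M \<subseteq> carrier L" using join_ideal_subset[OF ideal] .
  show thesis
  proof (rule that[OF ideal aM bM], rule ccontr)
    fix c assume c: "c \<in> carrier L" "c \<notin> M" and no: "\<not> (\<exists>i\<in>M. b \<sqsubseteq> i \<squnion> c)"
    define J where "J = {x \<in> carrier L. \<exists>i\<in>M. x \<sqsubseteq> i \<squnion> c}"
    have MJ: "M \<subseteq> J"
      using sub c join_left unfolding J_def by blast
    have "J \<in> A"
      using join_ideal_adjoin[OF ideal c(1)] MJ aM no unfolding A_def J_def by blast
    then have "J = M" using max MJ by blast
    moreover have "c \<in> J" using join_right[of a c] a aM c unfolding J_def by blast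
    ultimately show False using c by blast
  qed
qed

text \<open>
  The complement of a maximal ideal that contains \<open>a\<close> and avoids \<open>b\<close> is such a clan. For \<open>c0\<close>, \<open>c1\<close>
  outside the ideal, maximality yields one element of the ideal each; the join of the two serves
  both, and if \<open>c0\<close>, \<open>c1\<close> were not in contact, cancellation would put \<open>b\<close> into the ideal.
\<close>

lemma (in contact_cancellative_semilattice) clan_separates:
  assumes a: "a \<in> carrier S" and b: "b \<in> carrier S" and nle: "\<not> b \<sqsubseteq> a"
  shows "\<exists>F. clan S F \<and> b \<in> F \<and> a \<notin> F"
proof -
  obtain M where ideal: "join_ideal S M" and M: "a \<in> M" "b \<notin> M"
    and max: "\<And>c. \<lbrakk>c \<in> carrier S; c \<notin> M\<rbrakk> \<Longrightarrow> \<exists>i\<in>M. b \<sqsubseteq> i \<squnion> c"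
    using maximal_ideal_avoiding[OF a b nle] by metis
  have sub: "M \<subseteq> carrier S" using join_ideal_subset[OF ideal] .
  have "c0 \<delta> c1" if c: "c0 \<in> carrier S - M" "c1 \<in> carrier S - M" for c0 c1
  proof (rule ccontr)
    assume nc: "\<not> c0 \<delta> c1"
    obtain i j where ij: "i \<in> M" "j \<in> M" "b \<sqsubseteq> i \<squnion> c0" "b \<sqsubseteq> j \<squnion> c1"
      using max[of c0] max[of c1] c by auto
    then have carr: "i \<in> carrier S" "j \<in> carrier S" "c0 \<in> carrier S" "c1 \<in> carrier S"
      using sub c by auto
    have k: "i \<squnion> j \<in> M" using join_ideal_join_iff[OF ideal] ij carr by simp
    have "b \<sqsubseteq> (i \<squnion> j) \<squnion> c0" "b \<sqsubseteq> (i \<squnion> j) \<squnion> c1"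
      using le_join_mono[OF ij(3) join_left[of i j]] le_join_mono[OF ij(4) join_right[of i j]]
        carr b by simp_all
    then have "b \<sqsubseteq> i \<squnion> j"
      using contact_cancel[of "i \<squnion> j" b c0 c1] carr b nc by auto
    then have "b \<in> M" by (rule join_ideal_downward[OF ideal b k])
    with M show False by blast
  qed
  then have "clan S (carrier S - M)"
    using ideal unfolding clan_def join_ideal_def by auto
  with M b show ?thesis by blast
qed

lemma (in weak_contact_semilattice) bottom_not_in_clan:
  assumes "clan S F"
  shows "\<bottom> \<notin> F"
proof
  assume "\<bottom> \<in> F"
  then have "\<bottom> \<delta> \<bottom>" using assms unfolding clan_def by blast
  then have "\<bottom> \<sqsubset> \<bottom>" using contact_emp[of "\<bottom>" "\<bottom>"] by simp
  then show False unfolding lless_def using eq_is_equal by simp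
qed


section \<open>Powersets with a contact relation\<close>

definition powerset_contact_order :: "'b set \<Rightarrow> ('b set \<Rightarrow> 'b set \<Rightarrow> bool) \<Rightarrow> 'b set contact_order"
  where "powerset_contact_order X R =
    \<lparr>carrier = Pow X, eq = (=), le = (\<subseteq>), contact = R\<rparr>"

lemma powerset_contact_order_simps [simp]:
  "carrier (powerset_contact_order X R) = Pow X"
  "eq (powerset_contact_order X R) = (=)"
  "le (powerset_contact_order X R) = (\<subseteq>)"
  "contact (powerset_contact_order X R) = R"
  by (simp_all add: powerset_contact_order_def)

lemma complete_lattice_powerset: "complete_lattice (powerset_contact_order X R)"
  using powerset_is_complete_lattice[of X]
  unfolding complete_lattice_def complete_lattice_axioms_def partial_order_def
    partial_order_axioms_def weak_partial_order_def weak_partial_order_axioms_def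
    equivalence_def least_def greatest_def Upper_def Lower_def
    powerset_contact_order_simps partial_object.select_convs eq_object.select_convs
    gorder.select_convs
  .

lemma powerset_operations:
  fixes X R
  defines "L \<equiv> powerset_contact_order X R"
  shows "\<bottom>\<^bsub>L\<^esub> = {}"
    and "\<top>\<^bsub>L\<^esub> = X"
    and "\<lbrakk>U \<subseteq> X; V \<subseteq> X\<rbrakk> \<Longrightarrow> U \<squnion>\<^bsub>L\<^esub> V = U \<union> V"
    and "\<lbrakk>U \<subseteq> X; V \<subseteq> X\<rbrakk> \<Longrightarrow> U \<sqinter>\<^bsub>L\<^esub> V = U \<inter> V"
proof -
  interpret complete_lattice L unfolding L_def by (rule complete_lattice_powerset)
  have carr: "carrier L = Pow X" and le: "le L = (\<subseteq>)" unfolding L_def by simp_all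
  show "\<bottom>\<^bsub>L\<^esub> = {}" using bottom_lower[of "{}"] carr le by auto
  show "\<top>\<^bsub>L\<^esub> = X" using top_higher[of X] top_closed carr le by auto
  show "U \<squnion>\<^bsub>L\<^esub> V = U \<union> V" if "U \<subseteq> X" "V \<subseteq> X"
    using that join_left[of U V] join_right[of U V] join_le[of U "U \<union> V" V] carr le by auto
  show "U \<sqinter>\<^bsub>L\<^esub> V = U \<inter> V" if "U \<subseteq> X" "V \<subseteq> X"
    using that meet_left[of U V] meet_right[of U V] meet_le[of "U \<inter> V" U V] carr le by auto
qed

lemma atomic_boolean_lattice_powerset: "atomic_boolean_lattice (powerset_contact_order X R)"
proof -
  interpret L: complete_lattice "powerset_contact_order X R"
    by (rule complete_lattice_powerset)
  note ops = powerset_operations[where X = X and R = R]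
  show ?thesis
  proof unfold_locales
    fix U V W
    assume "U \<in> carrier (powerset_contact_order X R)" "V \<in> carrier (powerset_contact_order X R)"
      "W \<in> carrier (powerset_contact_order X R)"
    then have sub: "U \<subseteq> X" "V \<subseteq> X" "W \<subseteq> X" "V \<union> W \<subseteq> X" "U \<inter> V \<subseteq> X" "U \<inter> W \<subseteq> X" by auto
    then show "U \<sqinter>\<^bsub>powerset_contact_order X R\<^esub> (V \<squnion>\<^bsub>powerset_contact_order X R\<^esub> W) =
        (U \<sqinter>\<^bsub>powerset_contact_order X R\<^esub> V) \<squnion>\<^bsub>powerset_contact_order X R\<^esub>
        (U \<sqinter>\<^bsub>powerset_contact_order X R\<^esub> W)"
      by (simp add: ops Int_Un_distrib)
  next
    fix U assume "U \<in> carrier (powerset_contact_order X R)"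
    then have "U \<subseteq> X" by simp
    then show "\<exists>V\<in>carrier (powerset_contact_order X R).
        U \<squnion>\<^bsub>powerset_contact_order X R\<^esub> V = \<top>\<^bsub>powerset_contact_order X R\<^esub> \<and>
        U \<sqinter>\<^bsub>powerset_contact_order X R\<^esub> V = \<bottom>\<^bsub>powerset_contact_order X R\<^esub>"
      by (intro bexI[of _ "X - U"]) (auto simp: ops)
  next
    fix U assume "U \<in> carrier (powerset_contact_order X R)"
      "U \<noteq> \<bottom>\<^bsub>powerset_contact_order X R\<^esub>"
    then obtain u where "u \<in> U" "u \<in> X" by (auto simp: ops)
    then show "\<exists>p. atom (powerset_contact_order X R) p \<and> p \<sqsubseteq>\<^bsub>powerset_contact_order X R\<^esub> U"
      by (intro exI[of _ "{u}"]) (auto simp: atom_def ops)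
  qed
qed

text \<open>
  When \<open>\<phi>\<close> sends only \<open>\<bottom>\<close> to the empty set, this is the least weak contact relation on sets that
  makes \<open>\<phi>\<close> preserve contact: reflexivity at a common point and monotonicity force the first
  disjunct, monotonicity alone the second.
\<close>

definition induced_contact ::
  "('a, 'm) contact_order_scheme \<Rightarrow> ('a \<Rightarrow> 'b set) \<Rightarrow> 'b set \<Rightarrow> 'b set \<Rightarrow> bool" where
  "induced_contact S \<phi> U V \<longleftrightarrow> U \<inter> V \<noteq> {} \<or>
     (\<exists>a\<in>carrier S. \<exists>b\<in>carrier S. a \<delta>\<^bsub>S\<^esub> b \<and> \<phi> a \<subseteq> U \<and> \<phi> b \<subseteq> V)"

text \<open>
  Elements in contact are nonzero, so their images are nonempty, and hence so are the larger sets
  that the second disjunct puts in contact.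
\<close>

lemma weak_contact_induced:
  assumes S: "weak_contact S"
    and ne: "\<And>a. \<lbrakk>a \<in> carrier S; a \<noteq> \<bottom>\<^bsub>S\<^esub>\<rbrakk> \<Longrightarrow> \<phi> a \<noteq> {}"
  shows "weak_contact (powerset_contact_order X (induced_contact S \<phi>))" (is "weak_contact ?L")
proof -
  interpret S: weak_contact S by fact
  interpret L: complete_lattice ?L by (rule complete_lattice_powerset)
  note ops = powerset_operations[where X = X and R = "induced_contact S \<phi>"]
  have sym: "induced_contact S \<phi> V U" if "induced_contact S \<phi> U V" for U V
    using that S.contact_sym unfolding induced_contact_def by blast
  have nonempty: "U \<noteq> {}" if UV: "induced_contact S \<phi> U V" for U V
  proof -
    have "\<phi> a \<noteq> {}" if "a \<in> carrier S" "b \<in> carrier S" "a \<delta>\<^bsub>S\<^esub> b" for a b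
      using that S.contact_emp[of a b] S.eq_is_equal ne[of a] by (auto simp: lless_def)
    then show ?thesis using UV unfolding induced_contact_def by blast
  qed
  show ?thesis
  proof unfold_locales
    fix U V
    assume "U \<in> carrier ?L" "V \<in> carrier ?L"
    show "U \<delta>\<^bsub>?L\<^esub> V \<longleftrightarrow> V \<delta>\<^bsub>?L\<^esub> U" using sym by auto
    assume "U \<delta>\<^bsub>?L\<^esub> V"
    then have "induced_contact S \<phi> U V" by simp
    from nonempty[OF this] nonempty[OF sym[OF this]]
    show "\<bottom>\<^bsub>?L\<^esub> \<sqsubset>\<^bsub>?L\<^esub> U \<and> \<bottom>\<^bsub>?L\<^esub> \<sqsubset>\<^bsub>?L\<^esub> V" by (auto simp: lless_def ops)
  next
    fix U V U' V'
    assume "U \<delta>\<^bsub>?L\<^esub> V" "U \<sqsubseteq>\<^bsub>?L\<^esub> U'" "V \<sqsubseteq>\<^bsub>?L\<^esub> V'"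
    then show "U' \<delta>\<^bsub>?L\<^esub> V'" unfolding induced_contact_def powerset_contact_order_simps by blast
  next
    fix U assume "U \<noteq> \<bottom>\<^bsub>?L\<^esub>"
    then show "U \<delta>\<^bsub>?L\<^esub> U" by (simp add: ops induced_contact_def)
  qed
qed


section \<open>The clan representation\<close>

definition clans_through :: "('a, 'm) contact_order_scheme \<Rightarrow> 'a \<Rightarrow> 'a set set" where
  "clans_through S a = {F. clan S F \<and> a \<in> F}"

context contact_cancellative_semilattice
begin

text \<open>
  Separation by clans turns the representation into an order embedding, which gives injectivity
  and lets contact be reflected.
\<close>

lemma clans_through_subset_iff:
  assumes a: "a \<in> carrier S" and b: "b \<in> carrier S"
  shows "clans_through S b \<subseteq> clans_through S a \<longleftrightarrow> b \<sqsubseteq> a"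
proof
  assume "clans_through S b \<subseteq> clans_through S a"
  then show "b \<sqsubseteq> a" using clan_separates[OF a b] unfolding clans_through_def by blast
next
  assume "b \<sqsubseteq> a"
  then have "b \<squnion> a = a" using le_iff_join_eq a b by blast
  then show "clans_through S b \<subseteq> clans_through S a"
    using a b unfolding clans_through_def clan_def by force
qed

lemma clans_through_bottom: "clans_through S \<bottom> = {}"
  using bottom_not_in_clan unfolding clans_through_def by blast

lemma clans_through_nonempty:
  assumes "a \<in> carrier S" "a \<noteq> \<bottom>"
  shows "clans_through S a \<noteq> {}"
  using clans_through_subset_iff[of "\<bottom>" a] assms clans_through_bottom
    le_antisym[of a "\<bottom>"] bottom_lower[of a] by auto

text \<open>
  To reflect contact, a common point of two images is a clan through both elements, and a clan
  contains only pairs in contact; in the other case the images of two elements in contact are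
  included in the given images, and inclusion of images reflects to the order of \<open>S\<close>.
\<close>

lemma contact_embedding_clans_through:
  "contact_embedding S
     (powerset_contact_order {F. clan S F} (induced_contact S (clans_through S))) (clans_through S)"
  (is "contact_embedding S ?L _")
proof -
  have sub: "clans_through S a \<subseteq> {F. clan S F}" for a
    unfolding clans_through_def by blast
  have "inj_on (clans_through S) (carrier S)"
    using clans_through_subset_iff le_antisym by (intro inj_onI) blast
  moreover have "clans_through S (a \<squnion> b) = clans_through S a \<union> clans_through S b"
    if "a \<in> carrier S" "b \<in> carrier S" for a b
    using that unfolding clans_through_def clan_def by blast
  moreover have "induced_contact S (clans_through S) (clans_through S a) (clans_through S b) \<longleftrightarrow> a \<delta> b"
    if ab: "a \<in> carrier S" "b \<in> carrier S" for a b
  proof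
    assume "induced_contact S (clans_through S) (clans_through S a) (clans_through S b)"
    then consider F where "clan S F" "a \<in> F" "b \<in> F"
      | a' b' where "a' \<in> carrier S" "b' \<in> carrier S" "a' \<delta> b'"
          "clans_through S a' \<subseteq> clans_through S a" "clans_through S b' \<subseteq> clans_through S b"
      unfolding induced_contact_def clans_through_def by blast
    then show "a \<delta> b"
    proof cases
      case 1
      then show ?thesis unfolding clan_def by blast
    next
      case 2
      then have "a' \<sqsubseteq> a" "b' \<sqsubseteq> b" using clans_through_subset_iff ab by auto
      then show ?thesis using contact_ext[of a' b' a b] 2 ab by blast
    qed
  next
    assume "a \<delta> b"
    then show "induced_contact S (clans_through S) (clans_through S a) (clans_through S b)"
      using ab unfolding induced_contact_def by blast
  qed
  ultimately show ?thesis
    using sub by (auto simp: contact_embedding_def powerset_operations clans_through_bottom)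
qed

lemma embeddable_complete_atomic_boolean_algebra:
  "embeddable TYPE('a set set) weak_contact_complete_atomic_boolean_algebra S"
proof -
  let ?L = "powerset_contact_order {F. clan S F} (induced_contact S (clans_through S))"
  have "weak_contact ?L"
    using weak_contact_induced[OF weak_contact_axioms] clans_through_nonempty by blast
  then have "weak_contact_complete_atomic_boolean_algebra ?L"
    using complete_lattice_powerset atomic_boolean_lattice_powerset
    by (intro weak_contact_complete_atomic_boolean_algebra.intro)
  then show ?thesis
    using contact_embedding_clans_through unfolding embeddable_def by blast
qed

end


section \<open>The equivalence\<close>

lemma embeddable_mono:
  assumes "embeddable U K S" "\<And>T. K T \<Longrightarrow> K' T"
  shows "embeddable U K' S"
  using assms unfolding embeddable_def by blast

lemma weak_contact_boolean_algebra_if_complete_atomic: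
  assumes "weak_contact_complete_atomic_boolean_algebra L"
  shows "weak_contact_boolean_algebra L"
proof -
  interpret weak_contact_complete_atomic_boolean_algebra L by fact
  show ?thesis ..
qed

lemma weak_contact_distributive_lattice_if_boolean_algebra:
  assumes "weak_contact_boolean_algebra L"
  shows "weak_contact_distributive_lattice L"
proof -
  interpret weak_contact_boolean_algebra L by fact
  show ?thesis ..
qed

theorem theorem4p1:
  fixes S :: "('a, 'm) contact_order_scheme" (structure)
  assumes "weak_contact_semilattice S"
  defines "E1 \<equiv> embeddable TYPE('a set set) weak_contact_boolean_algebra S"
    and "E2 \<equiv> embeddable TYPE('a set set) weak_contact_distributive_lattice S"
    and "C3 \<equiv> \<forall>a\<in>carrier S. \<forall>b\<in>carrier S. \<forall>c0\<in>carrier S. \<forall>c1\<in>carrier S.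
               b \<sqsubseteq> a \<squnion> c0 \<and> b \<sqsubseteq> a \<squnion> c1 \<and> \<not> c0 \<delta> c1 \<longrightarrow> b \<sqsubseteq> a"
    and "E4 \<equiv> embeddable TYPE('a set set) weak_contact_complete_atomic_boolean_algebra S"
  shows "(E1 \<longleftrightarrow> E2) \<and> (E2 \<longleftrightarrow> C3) \<and> (C3 \<longleftrightarrow> E4) \<and>
    (embeddable TYPE('u) weak_contact_boolean_algebra S \<longrightarrow> E1) \<and>
    (embeddable TYPE('u) weak_contact_distributive_lattice S \<longrightarrow> E2) \<and>
    (embeddable TYPE('u) weak_contact_complete_atomic_boolean_algebra S \<longrightarrow> E4)"
proof -
  note to_boolean = embeddable_mono[OF _ weak_contact_boolean_algebra_if_complete_atomic]
  note to_distributive = embeddable_mono[OF _ weak_contact_distributive_lattice_if_boolean_algebra]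
  have C3: "C3 \<longleftrightarrow> contact_cancellative_semilattice S"
    using assms(1) unfolding C3_def contact_cancellative_semilattice_def
      contact_cancellative_semilattice_axioms_def by blast
  note from_any = contact_cancellative_if_embeddable[OF assms(1)]
  have 41: "E4 \<Longrightarrow> E1" unfolding E4_def E1_def by (rule to_boolean)
  have 12: "E1 \<Longrightarrow> E2" unfolding E1_def E2_def by (rule to_distributive)
  have 23: "E2 \<Longrightarrow> C3" unfolding C3 E2_def by (rule from_any)
  have 34: "C3 \<Longrightarrow> E4" unfolding C3 E4_def
    by (rule contact_cancellative_semilattice.embeddable_complete_atomic_boolean_algebra)
  have u2: "embeddable TYPE('u) weak_contact_distributive_lattice S \<Longrightarrow> C3"
    unfolding C3 by (rule from_any)
  have u1: "embeddable TYPE('u) weak_contact_boolean_algebra S \<Longrightarrow> C3"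
    by (rule u2[OF to_distributive])
  have u4: "embeddable TYPE('u) weak_contact_complete_atomic_boolean_algebra S \<Longrightarrow> C3"
    by (rule u1[OF to_boolean])
  show ?thesis using 41 12 23 34 u1 u2 u4 by blast
qed

end
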